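(* Every path $P$ in $\mathbb{R}^2$ is an $n$-path for some finite $n\in\mathbb{N}$, $n\ge 1$. That is, for every path $P$ there exist a radius $r>0$ and an integer $n\ge 1$ such that $R(P,r)^n=\mathbf{1}$, where $R(P,r)\in SO(3)$ is the rotation undergone by a ball of radius $r$ that rolls once along $P$ without slipping or pivoting.
   Context: **Paths.** A path $P$ is a finite curve in $\mathbb{R}^2$ given by a continuous map $\gamma:[0,1]\to\mathbb{R}^2$ that is piecewise $C^{1,\delta}$ for some $\delta\in(0,1]$. This means that $[0,1]$ can be divided into finitely many closed subintervals, on each of which $\gamma$ is differentiable with $\delta$-Hölder continuous derivative $\dot\gamma$. Corners, and in particular polygonal paths, are allowed. **Rolling.** Identify $\mathbb{R}^2$ with the horizontal plane $z=0$ in $\mathbb{R}^3$, and let $\hat z=(0,0,1)$. For $r>0$, a ball of radius $r$ resting on the plane rolls along $P$ without slipping and without pivoting (no rotation about the vertical axis), with its contact point in the plane tracing $\gamma$. Its orientation $Q(t)\in SO(3)$, $t\in[0,1]$, is the continuous solution of $$\dot Q(t)=\Omega(t)\,Q(t),\qquad Q(0)=\mathbf 1,$$ where the differential equation holds on each smooth piece of $\gamma$, and $\Omega(t)$ is the skew-symmetric matrix $x\mapsto \omega(t)\times x$ with $\omega(t)=\frac1r\,\hat z\times\dot\gamma(t)$. Define $R(P,r)=Q(1)\in SO(3)$. It does not depend on the (orientation-preserving) parametrization. If $P$ is repeated periodically by concatenating translated copies (each copy translated by the vector from the start to the end of $P$), then the rotation after rolling over $k$ consecutive copies is $R(P,r)^k$.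 The total motion over $k$ copies is a pure translation if and only if $R(P,r)^k=\mathbf 1$. **$n$-paths.** The path $P$ is kept fixed and the radius $r>0$ is free. For $n\in\mathbb{N}$, $n\ge1$, the path $P$ is called an $n$-path if $n$ is the smallest positive integer $k$ for which there exists $r>0$ with $R(P,r)^k=\mathbf 1$. In other words, for some radius a pure translation is reached after rolling over $n$ copies of $P$, and for no radius is a pure translation reached after rolling over fewer than $n$ copies. *)

theory Defs
  imports "HOL-Analysis.Analysis"
begin

text \<open>\<open>f'\<close> is the derivative of \<open>f\<close> on the closed interval from \<open>a\<close> to \<open>b\<close> (one-sided at
  the two ends), and it is Hoelder continuous there with exponent \<open>\<delta>\<close>.\<close>

definition has_holder_derivative_on ::
    "(real \<Rightarrow> real^2) \<Rightarrow> (real \<Rightarrow> real^2) \<Rightarrow> real \<Rightarrow> real \<Rightarrow> real \<Rightarrow> bool" where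
  "has_holder_derivative_on f f' \<delta> a b \<longleftrightarrow>
     (\<forall>t\<in>{a..b}. (f has_vector_derivative f' t) (at t within {a..b})) \<and>
     (\<exists>C. \<forall>s\<in>{a..b}. \<forall>t\<in>{a..b}. norm (f' s - f' t) \<le> C * \<bar>s - t\<bar> powr \<delta>)"

definition piecewise_C1_holder_path :: "(real \<Rightarrow> real^2) \<Rightarrow> bool" where
  "piecewise_C1_holder_path \<gamma> \<longleftrightarrow>
     path \<gamma> \<and>
     (\<exists>\<delta>\<in>{0<..1}. \<exists>(m::nat) (p::nat \<Rightarrow> real).
        p 0 = 0 \<and> p m = 1 \<and>
        (\<forall>i<m. p i < p (Suc i) \<and>
           (\<exists>\<gamma>'. has_holder_derivative_on \<gamma> \<gamma>' \<delta> (p i) (p (Suc i)))))"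

definition embed_plane :: "real^2 \<Rightarrow> real^3" where
  "embed_plane v = vector [v $ 1, v $ 2, 0]"

definition zhat :: "real^3" where
  "zhat = vector [0, 0, 1]"

text \<open>The matrix \<open>\<Omega>\<close> of the map taking \<open>x\<close> to the cross product of \<open>\<omega>\<close> and \<open>x\<close>, where
  \<open>\<omega>\<close> is the angular velocity of a ball of radius \<open>r\<close> whose contact point moves with
  velocity \<open>v\<close>.\<close>

definition rolling_generator :: "real \<Rightarrow> real^2 \<Rightarrow> real^3^3" where
  "rolling_generator r v = matrix (cross3 ((1 / r) *\<^sub>R cross3 zhat (embed_plane v)))"

text \<open>The differential equation is required on every closed subinterval on which \<open>\<gamma>\<close> is
  smooth, with one-sided derivatives at its ends; hence nothing depends on a choice of
  subdivision, and at a corner both one-sided equations are imposed.\<close>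

definition rolling_motion :: "(real \<Rightarrow> real^2) \<Rightarrow> real \<Rightarrow> (real \<Rightarrow> real^3^3) \<Rightarrow> bool" where
  "rolling_motion \<gamma> r Q \<longleftrightarrow>
     continuous_on {0..1} Q \<and>
     (\<forall>t\<in>{0..1}. rotation_matrix (Q t)) \<and>
     Q 0 = mat 1 \<and>
     (\<forall>a b \<gamma>'. \<forall>\<delta>\<in>{0<..1}.
        0 \<le> a \<and> a < b \<and> b \<le> 1 \<and> has_holder_derivative_on \<gamma> \<gamma>' \<delta> a b \<longrightarrow>
        (\<forall>t\<in>{a..b}.
           (Q has_vector_derivative rolling_generator r (\<gamma>' t) ** Q t) (at t within {a..b})))"

text \<open>The description is of the end value, because a motion is determined only on the unit
  interval.\<close>

definition rolling_rotation :: "(real \<Rightarrow> real^2) \<Rightarrow> real \<Rightarrow> real^3^3" where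
  "rolling_rotation \<gamma> r = (THE M. \<exists>Q. rolling_motion \<gamma> r Q \<and> M = Q 1)"

text \<open>Powers for the matrix product: on vectors, and so on matrices, the overloaded \<open>*\<close> and
  \<open>^\<close> act componentwise.\<close>

definition matrix_power :: "real^'n^'n \<Rightarrow> nat \<Rightarrow> real^'n^'n" where
  "matrix_power A k = (((**) A) ^^ k) (mat 1)"

definition is_n_path :: "nat \<Rightarrow> (real \<Rightarrow> real^2) \<Rightarrow> bool" where
  "is_n_path n \<gamma> \<longleftrightarrow>
     n \<ge> 1 \<and>
     (\<exists>r>0. matrix_power (rolling_rotation \<gamma> r) n = mat 1) \<and>
     (\<forall>k. 1 \<le> k \<and> k < n \<longrightarrow> \<not> (\<exists>r>0. matrix_power (rolling_rotation \<gamma> r) k = mat 1))"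

end

theory Submission
  imports Defs
begin

text \<open>With \<open>s = 1 / r\<close> the rolling equation is linear with generator proportional to \<open>s\<close>, so its
  end value \<open>R(s)\<close> is a power series in \<open>s\<close> (the Picard iteration), continuous with \<open>R(0) = 1\<close>.
  Either \<open>R(1) = 1\<close>, or the trace of \<open>R(s)\<close> drops from 3 to some smaller value as \<open>s\<close> runs from 0
  to 1 and therefore takes the value \<open>1 + 2 cos (2 \<pi> / n)\<close> for every large \<open>n\<close>; a rotation with
  that trace has order \<open>n\<close>.\<close>

section \<open>Linear Volterra equations\<close>

text \<open>Picard iteration turns the solution into a power series in \<open>s\<close> whose
  coefficients are iterated integrals with factorial decay; uniform convergence on compact sets of
  \<open>(s, t)\<close> gives continuity in both variables. The coefficient \<open>A\<close> need
  only be integrable against continuous functions, which admits velocities that jump at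
  corners.\<close>

lemma linear_volterra_solution:
  fixes A :: "real \<Rightarrow> 'a::euclidean_space \<Rightarrow> 'a"
  assumes lin: "\<And>t. linear (A t)"
    and bound: "\<And>t x. t \<in> {0..1} \<Longrightarrow> norm (A t x) \<le> K * norm x"
    and int: "\<And>g. continuous_on {0..1} g \<Longrightarrow> (\<lambda>t. A t (g t)) integrable_on {0..1}"
  obtains X where "\<And>s. continuous_on {0..1} (X s)"
    "\<And>s t. t \<in> {0..1} \<Longrightarrow> X s t = x0 + s *\<^sub>R integral {0..t} (\<lambda>u. A u (X s u))"
    "\<And>t. t \<in> {0..1} \<Longrightarrow> continuous_on UNIV (\<lambda>s. X s t)"
proof -
  define M where "M = \<bar>K\<bar>"
  have M0: "M \<ge> 0" by (simp add: M_def)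
  have bnd: "norm (A t x) \<le> M * norm x" if "t \<in> {0..1}" for t x
    unfolding M_def
    by (rule order_trans[OF bound[OF that]]) (simp add: mult_right_mono)
  define I where "I = (\<lambda>g t. integral {0..t} (\<lambda>u. A u (g u)))"
  have intt: "(\<lambda>u. A u (g u)) integrable_on {0..t}" if "continuous_on {0..1} g" "t \<in> {0..1}" for g t
    using integrable_subinterval_real[OF int[OF that(1)], of 0 t] that by auto
  define P where "P = rec_nat (\<lambda>_. x0) (\<lambda>_. I)"
  have P0: "P 0 t = x0" and PS: "P (Suc n) = I (P n)" for n t
    by (simp_all add: P_def)
  have contP: "continuous_on {0..1} (P n)" for n
  proof (induction n)
    case 0 show ?case using P0 by (simp add: continuous_on_def)
  next
    case (Suc n) then show ?case
      unfolding PS I_def using int indefinite_integral_continuous_1 by blast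
  qed
  \<comment> \<open>Each integration contributes a factor \<open>M\<close> and turns
    \<open>u ^ n / fact n\<close> into \<open>t ^ Suc n / fact (Suc n)\<close>.\<close>
  have normP: "norm (P n t) \<le> norm x0 * (M ^ n * t ^ n / fact n)" if "t \<in> {0..1}" for n t
    using that
  proof (induction n arbitrary: t)
    case 0 then show ?case by (simp add: P0)
  next
    case (Suc n)
    let ?g = "\<lambda>u. norm x0 * (M ^ Suc n * u ^ n / fact n)"
    have "((\<lambda>u. norm x0 * (M ^ Suc n * u ^ Suc n / fact (Suc n))) has_vector_derivative ?g u)
        (at u within {0..t})" for u
      unfolding has_real_derivative_iff_has_vector_derivative[symmetric]
      by (auto intro!: derivative_eq_intros simp del: power_Suc simp: divide_simps)
    then have g: "(?g has_integral norm x0 * (M ^ Suc n * t ^ Suc n / fact (Suc n))) {0..t}"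
      using fundamental_theorem_of_calculus[of 0 t "\<lambda>u. norm x0 * (M ^ Suc n * u ^ Suc n / fact (Suc n))" ?g] Suc.prems
      by simp
    have "norm (I (P n) t) \<le> integral {0..t} ?g"
      unfolding I_def
    proof (rule integral_norm_bound_integral)
      show "(\<lambda>u. A u (P n u)) integrable_on {0..t}" using intt contP Suc.prems by blast
      show "?g integrable_on {0..t}" using g by blast
      fix u assume "u \<in> {0..t}"
      then have u: "u \<in> {0..1}" using Suc.prems by auto
      show "norm (A u (P n u)) \<le> ?g u"
        using bnd[OF u, of "P n u"] mult_left_mono[OF Suc.IH[OF u] M0] by (simp add: mult_ac)
    qed
    then show ?case by (simp only: PS integral_unique[OF g])
  qed
  \<comment> \<open>Comparing powers of \<open>s\<close> in \<open>X = x0 + s I X\<close> forces the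
    coefficient of \<open>s ^ n\<close> to be the \<open>n\<close>-th iterate of
    \<open>I\<close>.\<close>
  define X where "X = (\<lambda>s t. \<Sum>n. s ^ n *\<^sub>R P n t)"
  have unif: "uniform_limit ({-S..S} \<times> {0..1}) (\<lambda>N (s, t). \<Sum>n<N. s ^ n *\<^sub>R P n t)
      (\<lambda>(s, t). X s t) sequentially" for S
  proof -
    have "uniform_limit ({-S..S} \<times> {0..1}) (\<lambda>N y. \<Sum>n<N. case y of (s, t) \<Rightarrow> s ^ n *\<^sub>R P n t)
      (\<lambda>y. \<Sum>n. case y of (s, t) \<Rightarrow> s ^ n *\<^sub>R P n t) sequentially"
    proof (rule Weierstrass_m_test)
      \<comment> \<open>The majorant is the exponential series of \<open>S * M\<close>.\<close>
      show "summable (\<lambda>n. norm x0 * ((S * M) ^ n /\<^sub>R fact n))"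
        using summable_exp_generic by (rule summable_mult)
      fix n :: nat and y :: "real \<times> real" assume "y \<in> {-S..S} \<times> {0..1}"
      then obtain s t where y: "y = (s, t)" and s: "\<bar>s\<bar> \<le> S" and t: "t \<in> {0..1}" by force
      have "norm (P n t) \<le> norm x0 * (M ^ n * t ^ n / fact n)" using normP t by blast
      also have "\<dots> \<le> norm x0 * (M ^ n * 1 / fact n)"
        using t M0 by (intro mult_left_mono divide_right_mono) (auto intro: power_le_one)
      finally have "norm (P n t) \<le> norm x0 * (M ^ n / fact n)" by simp
      moreover have "\<bar>s\<bar> ^ n \<le> S ^ n" using s by (intro power_mono) auto
      ultimately have "\<bar>s\<bar> ^ n * norm (P n t) \<le> S ^ n * (norm x0 * (M ^ n / fact n))"
        using s by (intro mult_mono) auto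
      then show "norm (case y of (s, t) \<Rightarrow> s ^ n *\<^sub>R P n t) \<le> norm x0 * ((S * M) ^ n /\<^sub>R fact n)"
        by (simp add: y power_abs power_mult_distrib field_simps)
    qed
    then show ?thesis by (simp add: X_def case_prod_unfold)
  qed
  have contXX: "continuous_on ({-S..S} \<times> {0..1}) (\<lambda>(s, t). X s t)" for S
  proof (rule uniform_limit_theorem[OF _ unif])
    show "\<forall>\<^sub>F N in sequentially. continuous_on ({-S..S} \<times> {0..1}) (\<lambda>(s, t). \<Sum>n<N. s ^ n *\<^sub>R P n t)"
      unfolding case_prod_unfold
      by (intro always_eventually allI continuous_intros continuous_on_compose2[OF contP]) auto
  qed simp
  have contt: "continuous_on {0..1} (X s)" for s
    by (rule continuous_on_compose2[OF contXX[of "\<bar>s\<bar>"], of _ "\<lambda>t. (s, t)", simplified])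
       (auto intro!: continuous_intros)
  have conts: "continuous_on UNIV (\<lambda>s. X s t)" if t: "t \<in> {0..1}" for t
  proof -
    \<comment> \<open>On an open interval every point is interior, so the choice
      \<open>S = \<bar>s\<bar> + 1\<close> below yields continuity at \<open>s\<close>.\<close>
    have cont: "continuous_on {-S<..<S} (\<lambda>s. X s t)" for S
      by (rule continuous_on_compose2[OF contXX[of S], of _ "\<lambda>s. (s, t)", simplified])
         (use t in \<open>auto intro!: continuous_intros\<close>)
    have "isCont (\<lambda>s. X s t) s" for s
      by (rule continuous_on_interior[OF cont[of "\<bar>s\<bar> + 1"]]) (simp, arith)
    then show ?thesis by (simp add: continuous_at_imp_continuous_on)
  qed
  have eq: "X s t = x0 + s *\<^sub>R I (X s) t" if t: "t \<in> {0..1}" for s t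
  proof -
    define Y where "Y = (\<lambda>N t. \<Sum>n<N. s ^ n *\<^sub>R P n t)"
    have Yu: "uniform_limit {0..1} Y (X s) sequentially"
    proof (rule uniform_limitI)
      fix e :: real assume "e > 0"
      have s_mem: "s \<in> {-\<bar>s\<bar>..\<bar>s\<bar>}" by auto
      from uniform_limitD[OF unif[of "\<bar>s\<bar>"] \<open>e > 0\<close>]
      show "\<forall>\<^sub>F n in sequentially. \<forall>x\<in>{0..1}. dist (Y n x) (X s x) < e"
        by (rule eventually_mono) (use s_mem in \<open>fastforce simp: Y_def\<close>)
    qed
    have Ycont: "continuous_on {0..1} (Y N)" for N
      unfolding Y_def by (intro continuous_intros contP)
    \<comment> \<open>Partial sums satisfy the integral equation up to a shift of the index; the
      equation for \<open>X s\<close> is the limit of this identity.\<close>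
    have Yrec: "Y (Suc N) t = x0 + s *\<^sub>R I (Y N) t" for N
    proof -
      have "I (Y N) t = integral {0..t} (\<lambda>u. \<Sum>n<N. s ^ n *\<^sub>R A u (P n u))"
        unfolding I_def Y_def using lin by (simp add: linear_sum linear_scale)
      also have "\<dots> = (\<Sum>n<N. s ^ n *\<^sub>R I (P n) t)"
        using intt[OF contP t] by (subst integral_sum) (auto simp: I_def intro: integrable_cmul)
      finally show ?thesis
        unfolding Y_def by (simp add: sum.lessThan_Suc_shift P0 PS scaleR_sum_right del: sum.lessThan_Suc)
    qed
    have lim1: "(\<lambda>N. Y (Suc N) t) \<longlonglongrightarrow> X s t"
      using tendsto_uniform_limitI[OF Yu t] by (rule LIMSEQ_Suc)
    have "(\<lambda>N. I (Y N) t) \<longlonglongrightarrow> I (X s) t"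
    proof (rule tendstoI)
      fix e :: real assume e: "e > 0"
      \<comment> \<open>Dividing by \<open>M + 1\<close> covers \<open>M = 0\<close> and makes the
        final estimate strict.\<close>
      have "e / (M + 1) > 0" using e M0 by simp
      from uniform_limitD[OF Yu this]
      show "\<forall>\<^sub>F N in sequentially. dist (I (Y N) t) (I (X s) t) < e"
      proof eventually_elim
        case (elim N)
        have "I (Y N) t - I (X s) t = integral {0..t} (\<lambda>u. A u (Y N u) - A u (X s u))"
          unfolding I_def by (intro integral_diff[symmetric] intt Ycont contt t)
        also have "norm \<dots> \<le> integral {0..t} (\<lambda>u. M * (e / (M + 1)))"
        proof (rule integral_norm_bound_integral)
          show "(\<lambda>u. A u (Y N u) - A u (X s u)) integrable_on {0..t}"
            by (intro integrable_diff intt Ycont contt t)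
          fix u assume "u \<in> {0..t}"
          then have u: "u \<in> {0..1}" using t by auto
          have "norm (A u (Y N u) - A u (X s u)) = norm (A u (Y N u - X s u))"
            by (simp add: linear_diff[OF lin])
          also have "\<dots> \<le> M * dist (Y N u) (X s u)" using bnd[OF u] by (simp add: dist_norm)
          also have "\<dots> \<le> M * (e / (M + 1))"
            using elim u M0 by (intro mult_left_mono) (auto simp: less_imp_le)
          finally show "norm (A u (Y N u) - A u (X s u)) \<le> M * (e / (M + 1))" .
        qed (rule integrable_const_ivl)
        also have "\<dots> = t * (M * (e / (M + 1)))" using t by simp
        also have "\<dots> \<le> 1 * (M * (e / (M + 1)))"
          using t M0 e by (intro mult_right_mono) auto
        also have "\<dots> < e" using e M0 by (simp add: field_simps)
        finally show ?case by (simp add: dist_norm)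
      qed
    qed
    then have "(\<lambda>N. x0 + s *\<^sub>R I (Y N) t) \<longlonglongrightarrow> x0 + s *\<^sub>R I (X s) t"
      by (intro tendsto_intros)
    then show ?thesis using LIMSEQ_unique[OF lim1] by (simp add: Yrec)
  qed
  show thesis
    using that[of X] contt conts eq by (simp add: I_def)
qed

section \<open>Rotations of finite order\<close>

lemma bounded_bilinear_matrix_mult:
  "bounded_bilinear ((**) :: real^'n^'m \<Rightarrow> real^'k^'n \<Rightarrow> real^'k^'m)"
  unfolding bilinear_conv_bounded_bilinear[symmetric] bilinear_def
  by (auto intro!: linearI simp: matrix_matrix_mult_def vec_eq_iff sum.distrib sum_distrib_left algebra_simps)

lemmas matrix_mult_distribs =
  bounded_bilinear.add_left[OF bounded_bilinear_matrix_mult]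
  bounded_bilinear.add_right[OF bounded_bilinear_matrix_mult]
  bounded_bilinear.diff_left[OF bounded_bilinear_matrix_mult]
  bounded_bilinear.diff_right[OF bounded_bilinear_matrix_mult]
  bounded_bilinear.minus_left[OF bounded_bilinear_matrix_mult]
  bounded_bilinear.minus_right[OF bounded_bilinear_matrix_mult]
  bounded_bilinear.scaleR_left[OF bounded_bilinear_matrix_mult]
  bounded_bilinear.scaleR_right[OF bounded_bilinear_matrix_mult]

text \<open>The middle coefficient is the sum of the principal 2 by 2 minors, expressed through
  traces so that it can be computed from a trace identity. In dimension three an entrywise expansion
  suffices.\<close>

lemma cayley_hamilton_3:
  fixes M :: "real^3^3"
  shows "M ** (M ** M) - trace M *\<^sub>R (M ** M) + ((trace M ^ 2 - trace (M ** M)) / 2) *\<^sub>R M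
     - det M *\<^sub>R mat 1 = 0"
  by (simp add: vec_eq_iff forall_3 matrix_matrix_mult_def sum_3 trace_def det_3 mat_def
      power2_eq_square field_simps)

text \<open>The cofactor matrix of a rotation is the rotation itself, so the two middle coefficients of
  the characteristic polynomial agree.\<close>

lemma rotation_matrix_3_cubic:
  fixes M :: "real^3^3"
  assumes "rotation_matrix M"
  shows "M ** (M ** M) = trace M *\<^sub>R (M ** M) - trace M *\<^sub>R M + mat 1"
proof -
  define s where "s = (trace M ^ 2 - trace (M ** M)) / 2"
  have o: "transpose M ** M = mat 1" and d: "det M = 1"
    using assms by (auto simp: rotation_matrix_def orthogonal_matrix)
  have o2: "transpose M ** (M ** B) = B" for B :: "real^3^3"
    using o by (simp add: matrix_mul_assoc)
  have ch: "M ** (M ** M) = trace M *\<^sub>R (M ** M) - s *\<^sub>R M + mat 1"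
    using cayley_hamilton_3[of M] d by (simp add: s_def[symmetric] algebra_simps)
  \<comment> \<open>Multiplying the cubic by the inverse \<open>transpose M\<close> lowers its
    degree; taking traces then gives a linear equation for \<open>s\<close>.\<close>
  have "M ** M = transpose M ** (M ** (M ** M))" by (simp add: o2)
  also have "\<dots> = trace M *\<^sub>R M - s *\<^sub>R mat 1 + transpose M"
    by (simp add: ch matrix_mult_distribs o2 o)
  finally have "trace (M ** M) = trace (trace M *\<^sub>R M - s *\<^sub>R mat 1 + transpose M)" by simp
  also have "\<dots> = trace M * trace M - s * 3 + trace M"
    by (simp add: trace_def sum_3 transpose_def mat_def algebra_simps)
  finally have "trace (M ** M) = trace M * trace M - s * 3 + trace M" .
  \<comment> \<open>By definition \<open>2 * s\<close> is
    \<open>trace M ^ 2 - trace (M ** M)\<close>, so the equation reads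
    \<open>2 * s = 3 * s - trace M\<close>.\<close>
  then have "s = trace M" using s_def unfolding power2_eq_square by argo
  with ch show ?thesis by simp
qed

text \<open>Expand the square and use that a rotation has squared norm 3. Consequently the trace is
  at most 3, with equality only at the identity.\<close>

lemma rotation_matrix_3_trace_defect:
  fixes M :: "real^3^3"
  assumes "rotation_matrix M"
  shows "norm (M - mat 1) ^ 2 = 2 * (3 - trace M)"
proof -
  have o: "transpose M ** M = mat 1"
    using assms by (auto simp: rotation_matrix_def orthogonal_matrix)
  then have "\<And>i. (transpose M ** M) $ i $ i = 1" by (simp add: mat_def)
  from this[of 1] this[of 2] this[of 3] show ?thesis
    by (simp add: power2_norm_eq_inner inner_vec_def sum_3 mat_def trace_def transpose_def
      matrix_matrix_mult_def algebra_simps)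
qed

section \<open>Recurrences whose characteristic roots are roots of unity\<close>

text \<open>Both sides obey the same second-order recurrence, by the addition formula for the sine.
  The factor \<open>sin \<theta>\<close> on the left avoids a division, and
  \<open>real k - 1\<close> is a real subtraction, equal to -1 at \<open>k = 0\<close>.\<close>

lemma chebyshev_recurrence:
  fixes f :: "nat \<Rightarrow> 'a::real_vector"
  assumes rec: "\<And>k. f (Suc (Suc k)) = (2 * cos \<theta>) *\<^sub>R f (Suc k) - f k"
  shows "sin \<theta> *\<^sub>R f k = sin (real k * \<theta>) *\<^sub>R f 1 - sin ((real k - 1) * \<theta>) *\<^sub>R f 0"
proof -
  have s: "sin ((x + 1) * \<theta>) = 2 * cos \<theta> * sin (x * \<theta>) - sin ((x - 1) * \<theta>)" for x
    by (simp add: ring_distribs sin_add sin_diff)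
  show ?thesis
  proof (induction k rule: induct_nat_012)
    case (ge2 k)
    have "sin \<theta> *\<^sub>R f (Suc (Suc k)) = (2 * cos \<theta>) *\<^sub>R (sin \<theta> *\<^sub>R f (Suc k)) - sin \<theta> *\<^sub>R f k"
      by (simp add: rec scaleR_diff_right mult.commute)
    also have "\<dots> = (2 * cos \<theta> * sin ((real k + 1) * \<theta>) - sin (real k * \<theta>)) *\<^sub>R f 1
        - (2 * cos \<theta> * sin (real k * \<theta>) - sin ((real k - 1) * \<theta>)) *\<^sub>R f 0"
      unfolding ge2 by (simp add: algebra_simps)
    also have "\<dots> = sin ((real k + 1 + 1) * \<theta>) *\<^sub>R f 1 - sin ((real k + 1) * \<theta>) *\<^sub>R f 0"
      by (simp only: s add_diff_cancel_right')
    finally show ?case by (simp add: add.commute)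
  qed simp_all
qed

text \<open>With \<open>t = 1 + 2 * c\<close> the characteristic polynomial factors as
  \<open>(x - 1) * (x^2 - 2 * c * x + 1)\<close>. Its roots are 1 and the two \<open>n\<close>-th
  roots of unity of angle \<open>2 * pi / n\<close> and its negative; \<open>n \<ge> 3\<close> keeps
  the three distinct.\<close>

lemma cubic_recurrence_periodic:
  fixes m :: "nat \<Rightarrow> 'a::real_vector"
  assumes rec: "\<And>k. m (k + 3) = t *\<^sub>R m (k + 2) - t *\<^sub>R m (k + 1) + m k"
    and t: "t = 1 + 2 * cos (2 * pi / real n)" and n: "n \<ge> 3"
  shows "m n = m 0"
proof -
  define \<theta> where "\<theta> = 2 * pi / real n"
  define c where "c = cos \<theta>"
  have "0 < \<theta>" "\<theta> < pi" using n by (auto simp: \<theta>_def field_simps)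
  then have s0: "sin \<theta> \<noteq> 0" using sin_gt_zero[of \<theta>] by simp
  have "cos \<theta> < cos 0" using \<open>0 < \<theta>\<close> \<open>\<theta> < pi\<close> by (intro cos_monotone_0_pi) auto
  then have c1: "2 - 2 * c \<noteq> 0" by (simp add: c_def)
  have t': "t = 1 + 2 * c" by (simp add: t c_def \<theta>_def)
  \<comment> \<open>The quadratic factor is applied to \<open>m\<close>; the remaining factor
    \<open>x - 1\<close> then says that \<open>e\<close> is constant.\<close>
  define e where "e = (\<lambda>k. m (Suc (Suc k)) - (2 * c) *\<^sub>R m (Suc k) + m k)"
  have "e (Suc k) = e k" for k
    using rec[of k] by (simp add: e_def t' numeral_eq_Suc algebra_simps)
  then have e: "e k = e 0" for k by (induction k) auto
  \<comment> \<open>The subtracted vector is the constant solution of the quadratic recurrence with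
    right side \<open>e 0\<close>, so \<open>f\<close> solves the homogeneous one.\<close>
  define f where "f = (\<lambda>k. m k - (1 / (2 - 2 * c)) *\<^sub>R e 0)"
  have fr: "f (Suc (Suc k)) = (2 * cos \<theta>) *\<^sub>R f (Suc k) - f k" for k
  proof -
    have "f (Suc (Suc k)) - (2 * c) *\<^sub>R f (Suc k) + f k = e k - ((2 - 2 * c) * (1 / (2 - 2 * c))) *\<^sub>R e 0"
      unfolding f_def e_def by (simp only: algebra_simps) (simp flip: scaleR_add_left)
    also have "\<dots> = 0" using e[of k] c1 by simp
    finally show ?thesis by (simp add: c_def algebra_simps)
  qed
  have n\<theta>: "real n * \<theta> = 2 * pi" using n by (simp add: \<theta>_def)
  then have "sin ((real n - 1) * \<theta>) = - sin \<theta>" by (simp add: left_diff_distrib sin_diff)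
  then have "sin \<theta> *\<^sub>R f n = sin \<theta> *\<^sub>R f 0"
    using chebyshev_recurrence[where f = f and \<theta> = \<theta> and k = n, OF fr] n\<theta> by simp
  then show ?thesis using s0 by (simp add: f_def)
qed

lemma matrix_power_Suc: "matrix_power A (Suc k) = A ** matrix_power A k"
  by (simp add: matrix_power_def)

text \<open>Multiplying the cubic identity for \<open>M\<close> by its powers gives the periodic
  recurrence, so no rotation axis has to be chosen.\<close>

lemma rotation_matrix_power_eq_one:
  fixes M :: "real^3^3"
  assumes M: "rotation_matrix M" and tr: "trace M = 1 + 2 * cos (2 * pi / real n)" and n: "n \<ge> 3"
  shows "matrix_power M n = mat 1"
proof -
  have "matrix_power M (k + 3) = trace M *\<^sub>R matrix_power M (k + 2) - trace M *\<^sub>R matrix_power M (k + 1)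
      + matrix_power M k" for k
  proof -
    have "matrix_power M (k + 3) = M ** (M ** M) ** matrix_power M k"
      by (simp add: numeral_eq_Suc matrix_power_Suc matrix_mul_assoc)
    also have "\<dots> = (trace M *\<^sub>R (M ** M) - trace M *\<^sub>R M + mat 1) ** matrix_power M k"
      by (simp only: rotation_matrix_3_cubic[OF M])
    finally show ?thesis
      by (simp add: numeral_eq_Suc matrix_power_Suc matrix_mul_assoc
         matrix_mult_distribs)
  qed
  from cubic_recurrence_periodic[of "matrix_power M", OF this tr n] show ?thesis
    by (simp add: matrix_power_def)
qed

text \<open>The angles \<open>2 * pi / n\<close> tend to 0 through positive values, so the
  corresponding traces approach 3 from below.\<close>

lemma trace_of_finite_order_near_3:
  assumes "x < 3"
  obtains n where "n \<ge> 3" "x < 1 + 2 * cos (2 * pi / real n)" "1 + 2 * cos (2 * pi / real n) < 3"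
proof -
  have "(\<lambda>n. 2 * pi / real n) \<longlonglongrightarrow> 0" by (rule lim_const_over_n)
  then have "(\<lambda>n. 1 + 2 * cos (2 * pi / real n)) \<longlonglongrightarrow> 1 + 2 * cos 0"
    by (intro tendsto_intros)
  then have "\<forall>\<^sub>F n in sequentially. x < 1 + 2 * cos (2 * pi / real n)"
    using assms by (intro order_tendstoD(1)) auto
  then obtain N where N: "\<And>n. n \<ge> N \<Longrightarrow> x < 1 + 2 * cos (2 * pi / real n)"
    by (auto simp: eventually_sequentially)
  define n where "n = max 3 N"
  have "0 < 2 * pi / real n" "2 * pi / real n \<le> pi" by (auto simp: n_def field_simps)
  then have "cos (2 * pi / real n) < cos 0" by (intro cos_monotone_0_pi) auto
  then show thesis using that[of n] N[of n] by (simp add: n_def)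
qed

section \<open>The rolling motion\<close>

lemma bounded_linear_transpose: "bounded_linear (transpose :: real^'n^'m \<Rightarrow> real^'m^'n)"
  unfolding linear_conv_bounded_linear[symmetric]
  by (rule linearI) (simp_all add: transpose_def vec_eq_iff)

lemma rolling_generator_components:
  "rolling_generator r v = vector [vector [0, 0, v$1 / r], vector [0, 0, v$2 / r], vector [- v$1 / r, - v$2 / r, 0]]"
  by (simp add: rolling_generator_def matrix_def vec_eq_iff forall_3 cross_components embed_plane_def
      zhat_def axis_def)

lemma bounded_linear_rolling_generator: "bounded_linear (rolling_generator r)"
  unfolding linear_conv_bounded_linear[symmetric]
  by (rule linearI) (simp_all add: rolling_generator_components vec_eq_iff forall_3 add_divide_distrib diff_divide_distrib)

text \<open>This makes \<open>1 / r\<close> the linear parameter \<open>s\<close> of the Volterra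
  equation.\<close>

lemma rolling_generator_scale: "rolling_generator r v = (1 / r) *\<^sub>R rolling_generator 1 v"
  by (simp add: rolling_generator_components vec_eq_iff forall_3)

lemma transpose_rolling_generator: "transpose (rolling_generator r v) = - rolling_generator r v"
  by (simp add: rolling_generator_components vec_eq_iff forall_3 transpose_def)

section \<open>Calculus on the smooth pieces of a path\<close>

lemma has_holder_derivative_on_continuous:
  assumes "has_holder_derivative_on f f' \<delta> a b" "\<delta> > 0"
  shows "continuous_on {a..b} f'"
proof -
  from assms obtain C where C: "\<And>s t. s \<in> {a..b} \<Longrightarrow> t \<in> {a..b} \<Longrightarrow> norm (f' s - f' t) \<le> C * \<bar>s - t\<bar> powr \<delta>"
    unfolding has_holder_derivative_on_def by blast
  show ?thesis
    unfolding continuous_on_def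
  proof
    fix t assume t: "t \<in> {a..b}"
    have "((\<lambda>s. \<bar>s - t\<bar>) \<longlongrightarrow> \<bar>t - t\<bar>) (at t within {a..b})"
      by (intro tendsto_intros)
    then have "((\<lambda>s. \<bar>s - t\<bar> powr \<delta>) \<longlongrightarrow> 0 powr \<delta>) (at t within {a..b})"
      using assms(2) by (intro tendsto_powr') auto
    then have "((\<lambda>s. C * \<bar>s - t\<bar> powr \<delta>) \<longlongrightarrow> 0) (at t within {a..b})"
      using tendsto_mult_right_zero by auto
    moreover have "\<forall>\<^sub>F s in at t within {a..b}. norm (f' s - f' t) \<le> C * \<bar>s - t\<bar> powr \<delta>"
      using C t by (auto simp: eventually_at_filter)
    ultimately have "((\<lambda>s. f' s - f' t) \<longlongrightarrow> 0) (at t within {a..b})"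
      by (rule Lim_null_comparison[rotated])
    then show "(f' \<longlongrightarrow> f' t) (at t within {a..b})" by (rule LIM_zero_cancel)
  qed
qed

text \<open>Inside a piece the chosen derivative is the two-sided one, so the witnesses of all
  pieces can be replaced by one global function.\<close>

lemma has_holder_derivative_on_vector_derivative:
  assumes "has_holder_derivative_on f f' \<delta> a b" "t \<in> {a<..<b}"
  shows "vector_derivative f (at t) = f' t"
proof -
  have "(f has_vector_derivative f' t) (at t within {a..b})"
    using assms(1)[unfolded has_holder_derivative_on_def, THEN conjunct1, rule_format, of t] assms(2)
    by simp
  then have "(f has_vector_derivative f' t) (at t)"
    using assms(2) by (simp add: at_within_Icc_at)
  then show ?thesis by (rule vector_derivative_at)
qed

text \<open>Induction over the breakpoints of a subdivision. It serves properties of the initial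
  interval \<open>{0..x}\<close>, which each smooth piece extends from \<open>a\<close> to
  \<open>b\<close>.\<close>

lemma smooth_pieces_induct:
  assumes "piecewise_C1_holder_path \<gamma>" and base: "Q 0"
    and step: "\<And>a b \<gamma>' \<delta>. 0 \<le> a \<Longrightarrow> a < b \<Longrightarrow> b \<le> 1 \<Longrightarrow> \<delta> \<in> {0<..1} \<Longrightarrow>
      has_holder_derivative_on \<gamma> \<gamma>' \<delta> a b \<Longrightarrow> Q a \<Longrightarrow> Q b"
  shows "Q 1"
proof -
  obtain \<delta> m p where \<delta>: "\<delta> \<in> {0<..1::real}" and p: "p (0::nat) = 0" "p m = 1"
    and pp: "\<And>i. i < m \<Longrightarrow> p i < p (Suc i)"
      "\<And>i. i < m \<Longrightarrow> \<exists>\<gamma>'. has_holder_derivative_on \<gamma> \<gamma>' \<delta> (p i) (p (Suc i))"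
    using assms(1) unfolding piecewise_C1_holder_path_def by blast
  have mono: "p a \<le> p b" if "a \<le> b" "b \<le> m" for a b
    using that
  proof (induction b rule: dec_induct)
    case (step b)
    then show ?case using pp(1)[of b] by simp
  qed simp
  have "Q (p i)" if "i \<le> m" for i
    using that
  proof (induction i)
    case 0 then show ?case using base p by simp
  next
    case (Suc i)
    then obtain \<gamma>' where "has_holder_derivative_on \<gamma> \<gamma>' \<delta> (p i) (p (Suc i))"
      using pp(2)[of i] by auto
    moreover have "0 \<le> p i" "p (Suc i) \<le> 1"
      using mono[of 0 i] mono[of "Suc i" m] p Suc.prems by auto
    ultimately show ?case using step \<delta> pp(1) Suc by simp
  qed
  from this[of m] p show ?thesis by simp
qed

text \<open>At a corner \<open>vector_derivative\<close> is a junk value; there are finitely many corners, so no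
  integral is affected.\<close>

definition velocity_generator :: "(real \<Rightarrow> real^2) \<Rightarrow> real \<Rightarrow> real^3^3" where
  "velocity_generator \<gamma> t = rolling_generator 1 (vector_derivative \<gamma> (at t))"

lemma velocity_generator_bounded:
  assumes "piecewise_C1_holder_path \<gamma>"
  shows "\<exists>K. \<forall>t\<in>{0..1}. norm (velocity_generator \<gamma> t) \<le> K"
proof (rule smooth_pieces_induct[OF assms])
  show "\<exists>K. \<forall>t\<in>{0..0}. norm (velocity_generator \<gamma> t) \<le> K" by auto
next
  fix a b \<delta> :: real and \<gamma>'
  assume ab: "0 \<le> a" "a < b" "b \<le> 1" and \<delta>: "\<delta> \<in> {0<..1}" and h: "has_holder_derivative_on \<gamma> \<gamma>' \<delta> a b"
    and "\<exists>K. \<forall>t\<in>{0..a}. norm (velocity_generator \<gamma> t) \<le> K"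
  then obtain K where K: "\<And>t. t \<in> {0..a} \<Longrightarrow> norm (velocity_generator \<gamma> t) \<le> K" by blast
  have "continuous_on {a..b} (\<lambda>t. rolling_generator 1 (\<gamma>' t))"
    using has_holder_derivative_on_continuous[OF h] \<delta>
    by (auto intro: bounded_linear.continuous_on[OF bounded_linear_rolling_generator])
  then have "bounded ((\<lambda>t. rolling_generator 1 (\<gamma>' t)) ` {a..b})"
    using compact_continuous_image compact_imp_bounded compact_Icc by blast
  then obtain L where L: "\<And>t. t \<in> {a..b} \<Longrightarrow> norm (rolling_generator 1 (\<gamma>' t)) \<le> L"
    unfolding bounded_iff by blast
  show "\<exists>K. \<forall>t\<in>{0..b}. norm (velocity_generator \<gamma> t) \<le> K"
  proof (intro exI ballI)
    fix t assume "t \<in> {0..b}"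
    \<comment> \<open>The point \<open>b\<close> may be a corner where
      \<open>vector_derivative\<close> is arbitrary, so its value enters the maximum separately;
      \<open>a\<close> is covered by the induction hypothesis.\<close>
    then consider "t \<in> {0..a}" | "t \<in> {a<..<b}" | "t = b" using ab by force
    then show "norm (velocity_generator \<gamma> t) \<le> max (max K L) (norm (velocity_generator \<gamma> b))"
    proof cases
      case 2
      then show ?thesis
        using L[of t] has_holder_derivative_on_vector_derivative[OF h 2]
        by (simp add: velocity_generator_def le_max_iff_disj)
    qed (use K in \<open>simp_all add: le_max_iff_disj\<close>)
  qed
qed

lemma velocity_generator_integrable:
  fixes g :: "real \<Rightarrow> real^3^3"
  assumes "piecewise_C1_holder_path \<gamma>" and g: "continuous_on {0..1} g"
  shows "(\<lambda>t. velocity_generator \<gamma> t ** g t) integrable_on {0..1}"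
proof (rule smooth_pieces_induct[OF assms(1)])
  show "(\<lambda>t. velocity_generator \<gamma> t ** g t) integrable_on {0..0}"
    using integrable_on_refl[of _ 0] by simp
next
  fix a b \<delta> :: real and \<gamma>'
  assume ab: "0 \<le> a" "a < b" "b \<le> 1" and \<delta>: "\<delta> \<in> {0<..1}" and h: "has_holder_derivative_on \<gamma> \<gamma>' \<delta> a b"
    and i: "(\<lambda>t. velocity_generator \<gamma> t ** g t) integrable_on {0..a}"
  have "continuous_on {a..b} (\<lambda>t. rolling_generator 1 (\<gamma>' t) ** g t)"
    using has_holder_derivative_on_continuous[OF h] \<delta> g ab
    by (intro bounded_bilinear.continuous_on[OF bounded_bilinear_matrix_mult]
        bounded_linear.continuous_on[OF bounded_linear_rolling_generator])
       (auto elim: continuous_on_subset)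
  then have "(\<lambda>t. rolling_generator 1 (\<gamma>' t) ** g t) integrable_on {a..b}"
    by (rule integrable_continuous_real)
  then have "(\<lambda>t. velocity_generator \<gamma> t ** g t) integrable_on {a..b}"
    \<comment> \<open>The two integrands can differ only at the ends of the piece.\<close>
    by (rule integrable_spike_finite[of "{a, b}", rotated 2])
       (auto simp: velocity_generator_def has_holder_derivative_on_vector_derivative[OF h])
  then show "(\<lambda>t. velocity_generator \<gamma> t ** g t) integrable_on {0..b}"
    by (rule Henstock_Kurzweil_Integration.integrable_combine[OF ab(1) less_imp_le[OF ab(2)] i])
qed

text \<open>On one closed piece the integrand is replaced by the continuous \<open>?W\<close> built
  from \<open>\<gamma>'\<close>. The fundamental theorem then gives the correct one-sided
  derivatives even at corners.\<close>

lemma integral_equation_imp_derivative: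
  fixes X :: "real \<Rightarrow> real^3^3"
  assumes \<gamma>: "piecewise_C1_holder_path \<gamma>" and cont: "continuous_on {0..1} X"
    and eq: "\<And>t. t \<in> {0..1} \<Longrightarrow>
      X t = x0 + (1 / r) *\<^sub>R integral {0..t} (\<lambda>u. velocity_generator \<gamma> u ** X u)"
    and ab: "0 \<le> a" "b \<le> 1" and h: "has_holder_derivative_on \<gamma> \<gamma>' \<delta> a b" and \<delta>: "\<delta> > 0"
    and t: "t \<in> {a..b}"
  shows "(X has_vector_derivative rolling_generator r (\<gamma>' t) ** X t) (at t within {a..b})"
proof -
  let ?V = "\<lambda>u. velocity_generator \<gamma> u ** X u" and ?W = "\<lambda>u. rolling_generator 1 (\<gamma>' u) ** X u"
  have int: "?V integrable_on {0..u}" if "u \<in> {0..1}" for u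
    using integrable_subinterval_real[OF velocity_generator_integrable[OF \<gamma> cont], of 0 u] that by auto
  have W: "continuous_on {a..b} ?W"
    using has_holder_derivative_on_continuous[OF h \<delta>] cont ab
    by (intro bounded_bilinear.continuous_on[OF bounded_bilinear_matrix_mult]
        bounded_linear.continuous_on[OF bounded_linear_rolling_generator])
       (auto elim: continuous_on_subset)
  have X: "X u = X a + (1 / r) *\<^sub>R integral {a..u} ?W" if u: "u \<in> {a..b}" for u
  proof -
    have "integral {0..a} ?V + integral {a..u} ?V = integral {0..u} ?V"
      using ab u by (intro Henstock_Kurzweil_Integration.integral_combine int) auto
    moreover have "integral {a..u} ?V = integral {a..u} ?W"
      using u by (intro integral_spike[of "{a, b}"])
        (auto simp: velocity_generator_def has_holder_derivative_on_vector_derivative[OF h])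
    ultimately have "integral {0..u} ?V = integral {0..a} ?V + integral {a..u} ?W" by simp
    moreover have "X u = x0 + (1 / r) *\<^sub>R integral {0..u} ?V" using ab u by (intro eq) auto
    moreover have "X a = x0 + (1 / r) *\<^sub>R integral {0..a} ?V" using ab u by (intro eq) auto
    ultimately show ?thesis by (simp only: scaleR_add_right add.assoc)
  qed
  have "((\<lambda>u. X a + (1 / r) *\<^sub>R integral {a..u} ?W) has_vector_derivative (1 / r) *\<^sub>R ?W t) (at t within {a..b})"
    using integral_has_vector_derivative[OF W t]
    by (auto intro!: derivative_eq_intros)
  then have "(X has_vector_derivative (1 / r) *\<^sub>R ?W t) (at t within {a..b})"
    by (rule has_vector_derivative_transform[OF t X, rotated])
  then show ?thesis
    using rolling_generator_scale[of r "\<gamma>' t"] by (simp add: scalar_matrix_assoc)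
qed

section \<open>Uniqueness and existence of the rolling motion\<close>

text \<open>Skew-symmetry of the generator makes the matrix \<open>Q\<^sub>1\<^sup>T Q\<^sub>2\<close> constant.\<close>

lemma rolling_solutions_orthogonal:
  fixes Q1 Q2 :: "real \<Rightarrow> real^3^3"
  assumes \<gamma>: "piecewise_C1_holder_path \<gamma>" and Q0: "Q1 0 = mat 1" "Q2 0 = mat 1"
    and der: "\<And>a b \<gamma>' \<delta> t Q. Q = Q1 \<or> Q = Q2 \<Longrightarrow> \<delta> \<in> {0<..1} \<Longrightarrow> 0 \<le> a \<Longrightarrow> a < b \<Longrightarrow> b \<le> 1 \<Longrightarrow>
      has_holder_derivative_on \<gamma> \<gamma>' \<delta> a b \<Longrightarrow> t \<in> {a..b} \<Longrightarrow>
      (Q has_vector_derivative rolling_generator r (\<gamma>' t) ** Q t) (at t within {a..b})"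
  shows "\<forall>t\<in>{0..1}. transpose (Q1 t) ** Q2 t = mat 1"
proof (rule smooth_pieces_induct[OF \<gamma>, where Q = "\<lambda>x. \<forall>t\<in>{0..x}. transpose (Q1 t) ** Q2 t = mat 1"])
  show "\<forall>t\<in>{0..0}. transpose (Q1 t) ** Q2 t = mat 1" by (simp add: Q0)
next
  fix a b \<delta> :: real and \<gamma>'
  assume ab: "0 \<le> a" "a < b" "b \<le> 1" and \<delta>: "\<delta> \<in> {0<..1}" and h: "has_holder_derivative_on \<gamma> \<gamma>' \<delta> a b"
    and IH: "\<forall>t\<in>{0..a}. transpose (Q1 t) ** Q2 t = mat 1"
  have "((\<lambda>t. transpose (Q1 t) ** Q2 t) has_derivative (\<lambda>h. 0)) (at t within {a..b})"
    if t: "t \<in> {a..b}" for t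
  proof -
    let ?G = "rolling_generator r (\<gamma>' t)"
    have "((\<lambda>t. transpose (Q1 t)) has_vector_derivative transpose (?G ** Q1 t)) (at t within {a..b})"
      using der[of Q1, OF _ \<delta> ab h t]
      by (intro bounded_linear.has_vector_derivative[OF bounded_linear_transpose]) auto
    from bounded_bilinear.has_vector_derivative[OF bounded_bilinear_matrix_mult this der[of Q2, OF _ \<delta> ab h t]]
    have "((\<lambda>t. transpose (Q1 t) ** Q2 t) has_vector_derivative
        transpose (Q1 t) ** (?G ** Q2 t) + transpose (?G ** Q1 t) ** Q2 t) (at t within {a..b})"
      by simp
    moreover have "transpose (Q1 t) ** (?G ** Q2 t) + transpose (?G ** Q1 t) ** Q2 t = 0"
      by (simp add: matrix_transpose_mul transpose_rolling_generator matrix_mul_assoc matrix_mult_distribs)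
    ultimately show ?thesis by (simp add: has_vector_derivative_def)
  qed
  then obtain c where c: "\<forall>t\<in>{a..b}. transpose (Q1 t) ** Q2 t = c"
    using has_derivative_zero_constant[OF convex_real_interval(5), of a b "\<lambda>t. transpose (Q1 t) ** Q2 t"]
    by blast
  \<comment> \<open>The new piece shares the point \<open>a\<close> with the interval already
    treated.\<close>
  moreover have "c = mat 1" using c IH ab by force
  ultimately show "\<forall>t\<in>{0..b}. transpose (Q1 t) ** Q2 t = mat 1" using IH by force
qed

text \<open>The constant product says that \<open>transpose (Q1 1)\<close> is inverse to
  \<open>Q2 1\<close>, and it is inverse to \<open>Q1 1\<close> as well. This justifies the definite
  description in \<open>rolling_rotation\<close>.\<close>

lemma rolling_motion_end_unique:
  assumes "piecewise_C1_holder_path \<gamma>" "rolling_motion \<gamma> r Q1" "rolling_motion \<gamma> r Q2"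
  shows "Q1 1 = Q2 1"
proof -
  have "transpose (Q1 1) ** Q2 1 = mat 1"
    using rolling_solutions_orthogonal[OF assms(1), of Q1 Q2 r] assms(2,3)
    unfolding rolling_motion_def by fastforce
  moreover have "Q1 1 ** transpose (Q1 1) = mat 1"
    using assms(2) unfolding rolling_motion_def rotation_matrix_def orthogonal_matrix_def by auto
  ultimately show ?thesis
    by (metis matrix_mul_assoc matrix_mul_lid matrix_mul_rid)
qed

lemma rolling_rotation_eq:
  assumes "piecewise_C1_holder_path \<gamma>" "rolling_motion \<gamma> r Q"
  shows "rolling_rotation \<gamma> r = Q 1"
  unfolding rolling_rotation_def
proof (rule the_equality)
  show "\<exists>Q'. rolling_motion \<gamma> r Q' \<and> Q 1 = Q' 1" using assms(2) by blast
  show "M = Q 1" if "\<exists>Q'. rolling_motion \<gamma> r Q' \<and> M = Q' 1" for M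
    using that rolling_motion_end_unique[OF assms(1) _ assms(2)] by blast
qed

text \<open>The determinant is continuous, takes only the values 1 and -1, and starts at 1.\<close>

lemma rotation_matrix_of_continuous_orthogonal:
  fixes Q :: "real \<Rightarrow> real^'n^'n"
  assumes cont: "continuous_on {0..1} Q" and orth: "\<And>t. t \<in> {0..1} \<Longrightarrow> orthogonal_matrix (Q t)"
    and Q0: "Q 0 = mat 1" and t: "t \<in> {0..1}"
  shows "rotation_matrix (Q t)"
proof -
  have cont_det: "continuous_on {0..1} (\<lambda>t. det (Q t))"
    unfolding det_def by (intro continuous_intros cont)
  have det: "\<And>t. t \<in> {0..1} \<Longrightarrow> det (Q t) = 1 \<or> det (Q t) = -1"
    using orth det_orthogonal_matrix by blast
  have "det (Q t) \<noteq> -1"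
  proof
    assume "det (Q t) = -1"
    then have "\<exists>x. 0 \<le> x \<and> x \<le> t \<and> det (Q x) = 0"
      using t Q0 by (intro IVT2') (auto simp: det_I intro: continuous_on_subset[OF cont_det])
    then show False using det t by force
  qed
  then show ?thesis
    using orth[OF t] det_orthogonal_matrix rotation_matrix_def by blast
qed

text \<open>The family is indexed by \<open>s = 1 / r\<close>, so that \<open>s = 0\<close>, the
  limit of infinite radius in which the ball does not turn, is an ordinary parameter value.\<close>

lemma rolling_motion_exists:
  assumes \<gamma>: "piecewise_C1_holder_path \<gamma>"
  obtains X where "\<And>r. rolling_motion \<gamma> r (X (1 / r))" "X 0 1 = mat 1"
    "continuous_on UNIV (\<lambda>s. X s 1)"
proof -
  obtain L where L: "\<And>t. t \<in> {0..1} \<Longrightarrow> norm (velocity_generator \<gamma> t) \<le> L"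
    using velocity_generator_bounded[OF \<gamma>] by blast
  obtain C where C: "C > 0" "\<And>A B. norm ((A :: real^3^3) ** (B :: real^3^3)) \<le> norm A * norm B * C"
    using bounded_bilinear.pos_bounded[OF bounded_bilinear_matrix_mult] by blast
  have "norm (velocity_generator \<gamma> t ** B) \<le> (L * C) * norm B" if "t \<in> {0..1}" for t and B :: "real^3^3"
  proof -
    have "norm (velocity_generator \<gamma> t ** B) \<le> norm (velocity_generator \<gamma> t) * norm B * C"
      by (rule C)
    also have "\<dots> \<le> L * norm B * C"
      using L[OF that] C by (intro mult_right_mono) auto
    finally show ?thesis by (simp add: mult_ac)
  qed
  note bound = this
  have lin: "linear ((**) (velocity_generator \<gamma> t) :: real^3^3 \<Rightarrow> real^3^3)" for t
    by (intro bounded_linear.linear bounded_bilinear.bounded_linear_right bounded_bilinear_matrix_mult)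
  obtain X :: "real \<Rightarrow> real \<Rightarrow> real^3^3" where cont: "\<And>s. continuous_on {0..1} (X s)"
    and eq: "\<And>s t. t \<in> {0..1} \<Longrightarrow>
      X s t = mat 1 + s *\<^sub>R integral {0..t} (\<lambda>u. velocity_generator \<gamma> u ** X s u)"
    and conts: "\<And>t. t \<in> {0..1} \<Longrightarrow> continuous_on UNIV (\<lambda>s. X s t)"
    by (rule linear_volterra_solution[where A = "\<lambda>t. (**) (velocity_generator \<gamma> t)" and ?x0.0 = "mat 1",
          OF lin bound velocity_generator_integrable[OF \<gamma>]]) auto
  have X0: "X s 0 = mat 1" for s using eq[of 0 s] by simp
  have "rolling_motion \<gamma> r (X (1 / r))" for r
  proof -
    have der: "(X (1 / r) has_vector_derivative rolling_generator r (\<gamma>' t) ** X (1 / r) t) (at t within {a..b})"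
      if "\<delta> \<in> {0<..1}" "0 \<le> a" "a < b" "b \<le> 1" "has_holder_derivative_on \<gamma> \<gamma>' \<delta> a b" "t \<in> {a..b}"
      for a b \<gamma>' \<delta> t
      using that by (intro integral_equation_imp_derivative[OF \<gamma> cont eq]) auto
    \<comment> \<open>Comparing the solution with itself yields its orthogonality.\<close>
    have "\<forall>t\<in>{0..1}. transpose (X (1 / r) t) ** X (1 / r) t = mat 1"
      by (rule rolling_solutions_orthogonal[where ?Q1.0 = "X (1 / r)" and ?Q2.0 = "X (1 / r)", OF \<gamma> X0 X0]) (use der in blast)
    then have "rotation_matrix (X (1 / r) t)" if "t \<in> {0..1}" for t
      using that by (intro rotation_matrix_of_continuous_orthogonal[OF cont _ X0])
        (auto simp: orthogonal_matrix)
    then show ?thesis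
      unfolding rolling_motion_def using cont X0 der by blast
  qed
  moreover have "X 0 1 = mat 1" using eq[of 1 0] by simp
  ultimately show thesis using that[of X] conts[of 1] by auto
qed

section \<open>Choice of the radius and the minimal number of copies\<close>

theorem theorem1:
  fixes \<gamma> :: "real \<Rightarrow> real^2"
  assumes "piecewise_C1_holder_path \<gamma>"
  shows "(\<exists>n\<ge>1. is_n_path n \<gamma>) \<and>
         (\<exists>r>0. \<exists>n\<ge>1. matrix_power (rolling_rotation \<gamma> r) n = mat 1)"
proof -
  obtain X where X: "\<And>r. rolling_motion \<gamma> r (X (1 / r))" and X0: "X 0 1 = mat 1"
    and cont: "continuous_on UNIV (\<lambda>s. X s 1)"
    using rolling_motion_exists[OF assms] by blast
  have R: "rolling_rotation \<gamma> r = X (1 / r) 1" for r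
    by (rule rolling_rotation_eq[OF assms X])
  have rot: "rotation_matrix (X s 1)" for s
    \<comment> \<open>\<open>1 / (1 / s) = s\<close> holds for every real \<open>s\<close>,
      including 0 because \<open>1 / 0 = 0\<close>.\<close>
    using X[of "1 / s"] by (simp add: rolling_motion_def)
  have "\<exists>r>0. \<exists>n\<ge>1. matrix_power (rolling_rotation \<gamma> r) n = mat 1"
  proof (cases "trace (X 1 1) = 3")
    case True
    then have "X 1 1 = mat 1" using rotation_matrix_3_trace_defect[OF rot, of 1] by simp
    then have "matrix_power (rolling_rotation \<gamma> 1) 1 = mat 1" by (simp add: R matrix_power_def)
    then show ?thesis by (intro exI[of _ "1::real"] exI[of _ "1::nat"] conjI) simp_all
  next
    case False
    have "2 * (3 - trace (X 1 1)) \<ge> 0"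
      unfolding rotation_matrix_3_trace_defect[OF rot, symmetric] by (rule zero_le_power2)
    with False have "trace (X 1 1) < 3" by simp
    then obtain n where n: "n \<ge> 3" "trace (X 1 1) < 1 + 2 * cos (2 * pi / real n)"
      "1 + 2 * cos (2 * pi / real n) < 3"
      using trace_of_finite_order_near_3 by blast
    have "continuous_on {0..1} (\<lambda>s. trace (X s 1))"
      unfolding trace_def by (intro continuous_intros continuous_on_subset[OF cont]) auto
    moreover have tr0: "trace (X 0 1) = 3" by (simp add: X0 trace_I)
    ultimately obtain s where s: "0 \<le> s" "s \<le> 1" "trace (X s 1) = 1 + 2 * cos (2 * pi / real n)"
      using IVT2'[of "\<lambda>s. trace (X s 1)" 1 "1 + 2 * cos (2 * pi / real n)" 0] n by auto
    \<comment> \<open>At \<open>s = 0\<close> the trace is 3, above the target value; hence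
      \<open>1 / s\<close> is a genuine radius.\<close>
    then have "s > 0" using tr0 n(3) by (cases "s = 0") auto
    moreover have "matrix_power (rolling_rotation \<gamma> (1 / s)) n = mat 1"
      using rotation_matrix_power_eq_one[OF rot s(3) n(1)] by (simp add: R)
    ultimately show ?thesis
      using n(1) by (intro exI[of _ "1 / s"] exI[of _ n] conjI) auto
  qed
  moreover from this have "\<exists>n\<ge>1. is_n_path n \<gamma>"
  proof -
    \<comment> \<open>The least exponent that works for some radius is the \<open>n\<close> of an
      \<open>n\<close>-path.\<close>
    let ?P = "\<lambda>n. n \<ge> 1 \<and> (\<exists>r>0. matrix_power (rolling_rotation \<gamma> r) n = mat 1)"
    have "\<exists>n. ?P n" using calculation by blast
    from LeastI_ex[OF this] not_less_Least[of _ ?P] have "is_n_path (Least ?P) \<gamma>"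
      unfolding is_n_path_def by blast
    then show ?thesis using is_n_path_def by blast
  qed
  ultimately show ?thesis by blast
qed

end
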